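(* Let $\alpha_t,\beta_t\geq 0$ for $t=1,\dots,T$, let $p_t(d)=\beta_t-\alpha_t d$ be an affine inverse demand curve, and let the Cournot revenue of producer $i$ at time $t$ be $$P_{it}(q_{it},q_{-it})=\Big(\beta_t-\alpha_t\sum_{k=1}^Iq_{kt}\Big)q_{it}.$$ Define $$F_{t}(q_t)=\int_0^{d_t}p_t(x)\,dx-\frac12\alpha_t \sum_{i=1}^Iq_{it}^2,\qquad d_t=\sum_{i=1}^Iq_{it}.$$ Then for all $q_t\in\mathbb{R}^I$, $x_i\in\mathbb{R}$, $t=1,\dots,T$ and $i=1,\dots,I$, $$F_t(q_{it},q_{-it})-F_t(x_i,q_{-it})=P_{it}(q_{it},q_{-it})-P_{it}(x_i,q_{-it}).$$
   Context: $I$ and $T$ are positive integers; $q_t=(q_{1t},\dots,q_{It})\in\mathbb{R}^I$ collects the production quantities of producers $i=1,\dots,I$ at time $t$, and $q_{-it}=(q_{kt})_{k\neq i}$. For a function of $q_t$, $(x_i,q_{-it})$ denotes $q_t$ with its $i$-th component replaced by $x_i$; in particular $P_{it}(x_i,q_{-it})=(\beta_t-\alpha_t(x_i+\sum_{k\ne i}q_{kt}))x_i$. *)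

theory Defs
  imports "HOL-Analysis.Analysis"
begin

definition inverse_demand :: "(nat \<Rightarrow> real) \<Rightarrow> (nat \<Rightarrow> real) \<Rightarrow> nat \<Rightarrow> real \<Rightarrow> real" where
  "inverse_demand \<alpha> \<beta> t d = \<beta> t - \<alpha> t * d"

(* The producers are the elements of the finite index type 'i, so I = CARD('i). *)

definition total_quantity :: "real ^ 'i \<Rightarrow> real" where
  "total_quantity q = (\<Sum>k\<in>UNIV. q $ k)"

definition cournot_revenue ::
    "(nat \<Rightarrow> real) \<Rightarrow> (nat \<Rightarrow> real) \<Rightarrow> 'i \<Rightarrow> nat \<Rightarrow> real ^ 'i \<Rightarrow> real" where
  "cournot_revenue \<alpha> \<beta> i t q = (\<beta> t - \<alpha> t * (\<Sum>k\<in>UNIV. q $ k)) * q $ i"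

(* Quantities may be negative, so the upper limit of integration may lie below 0; the interval
   integral is oriented, i.e. it is minus the integral over {d<..<0} when d < 0. *)
definition cournot_potential ::
    "(nat \<Rightarrow> real) \<Rightarrow> (nat \<Rightarrow> real) \<Rightarrow> nat \<Rightarrow> real ^ 'i \<Rightarrow> real" where
  "cournot_potential \<alpha> \<beta> t q =
     (LBINT x=ereal 0..ereal (total_quantity q). inverse_demand \<alpha> \<beta> t x)
       - 1 / 2 * \<alpha> t * (\<Sum>k\<in>UNIV. (q $ k)\<^sup>2)"

(* The vector (x, q_{-i}). *)
definition replace_component :: "real ^ 'i \<Rightarrow> 'i \<Rightarrow> real \<Rightarrow> real ^ 'i" where
  "replace_component q i x = (\<chi> k. if k = i then x else q $ k)"

end

theory Submission
  imports Defs
begin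

text \<open>With d the total and s = d - q_i the rivals' total, the potential is \<beta> d -
  \<alpha> d^2/2 - (\<alpha>/2) * (sum of q_k^2). As d^2 = q_i^2 + 2 s q_i + s^2, the two quadratic
  terms together contribute -\<alpha> q_i^2 - \<alpha> s q_i plus terms free of q_i. So the
  potential is the revenue (\<beta> - \<alpha> (s + q_i)) q_i plus a function of q_{-i}, which
  cancels in the difference. \<open>LBINT_inverse_demand\<close> evaluates the integral;
  \<open>sum_replace_component\<close> tracks the deviation.\<close>

lemma LBINT_inverse_demand:
  "(LBINT x=ereal 0..ereal d. inverse_demand \<alpha> \<beta> t x) = \<beta> t * d - \<alpha> t * d\<^sup>2 / 2"
proof -
  have "(LBINT x=ereal 0..ereal d. inverse_demand \<alpha> \<beta> t x)
      = (\<beta> t * d - \<alpha> t * d\<^sup>2 / 2) - (\<beta> t * 0 - \<alpha> t * 0\<^sup>2 / 2)"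
  \<comment> \<open>This form of the fundamental theorem respects orientation, so negative d needs
    no separate case; hence the interval from \<open>min 0 d\<close> to
    \<open>max 0 d\<close>.\<close>
  proof (rule interval_integral_FTC_finite)
    show "continuous_on {min 0 d..max 0 d} (inverse_demand \<alpha> \<beta> t)"
      unfolding inverse_demand_def by (intro continuous_intros)
  next
    fix x :: real
    have "((\<lambda>x. \<beta> t * x - \<alpha> t * x\<^sup>2 / 2) has_real_derivative inverse_demand \<alpha> \<beta> t x)
        (at x within {min 0 d..max 0 d})"
      unfolding inverse_demand_def by (auto intro!: derivative_eq_intros)
    then show "((\<lambda>x. \<beta> t * x - \<alpha> t * x\<^sup>2 / 2) has_vector_derivative inverse_demand \<alpha> \<beta> t x)
        (at x within {min 0 d..max 0 d})"
      by (simp add: has_real_derivative_iff_has_vector_derivative)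
  qed
  then show ?thesis by simp
qed

text \<open>Only the summand at i changes. A general f lets one lemma serve both the total quantity
  and the sum of squares.\<close>

lemma sum_replace_component:
  fixes q :: "real ^ 'i" and f :: "real \<Rightarrow> real"
  shows "(\<Sum>k\<in>UNIV. f (replace_component q i x $ k)) = (\<Sum>k\<in>UNIV. f (q $ k)) - f (q $ i) + f x"
proof -
  have "(\<Sum>k\<in>UNIV - {i}. f (replace_component q i x $ k)) = (\<Sum>k\<in>UNIV - {i}. f (q $ k))"
    by (intro sum.cong) (auto simp: replace_component_def)
  then show ?thesis
    by (simp add: sum.remove[of UNIV i] replace_component_def)
qed

theorem mainTheorem6:
  fixes \<alpha> \<beta> :: "nat \<Rightarrow> real" and T :: nat
  assumes "T \<ge> 1"
    and "\<And>t. t \<in> {1..T} \<Longrightarrow> \<alpha> t \<ge> 0"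
    and "\<And>t. t \<in> {1..T} \<Longrightarrow> \<beta> t \<ge> 0"
  shows "\<forall>(q :: real ^ 'i) (x :: real). \<forall>t\<in>{1..T}. \<forall>i :: 'i.
           cournot_potential \<alpha> \<beta> t q - cournot_potential \<alpha> \<beta> t (replace_component q i x)
         = cournot_revenue \<alpha> \<beta> i t q - cournot_revenue \<alpha> \<beta> i t (replace_component q i x)"
proof (intro allI ballI)
  fix q :: "real ^ 'i" and x :: real and t :: nat and i :: 'i
  have component: "replace_component q i x $ i = x"
    by (simp add: replace_component_def)
  show "cournot_potential \<alpha> \<beta> t q - cournot_potential \<alpha> \<beta> t (replace_component q i x)
      = cournot_revenue \<alpha> \<beta> i t q - cournot_revenue \<alpha> \<beta> i t (replace_component q i x)"
    \<comment> \<open>After rewriting, both sums are taken over the original q and act as atoms;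
      what remains is a polynomial identity in which the sum of squares cancels.\<close>
    unfolding cournot_potential_def cournot_revenue_def total_quantity_def LBINT_inverse_demand
      sum_replace_component[where f = "\<lambda>y. y"] sum_replace_component[where f = "\<lambda>y. y\<^sup>2"] component
    by (simp add: power2_eq_square field_simps)
qed

end
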